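(* Let $u\in S$ be an analyzing vector for $(S,\pi,Y)$. Then: (a) $W_u(v)*W_u(u)=W_u(v)$ for all $v\in \mathrm{Co}_S^uY$. (b) The space $\mathrm{Co}_S^uY$ (with norm $\|\phi\|=\|W_u(\phi)\|_Y$) is a $\pi^*$-invariant Banach space. (c) $W_u:\mathrm{Co}_S^uY\to Y$ intertwines $\pi^*$ and left translation, i.e. $W_u(\pi^*(y)\phi)=\ell_yW_u(\phi)$ for $y\in G$. (d) $\mathrm{Co}_S^uY=\{\pi^*(F)u\mid F\in Y_u\}$. (e) $W_u:\mathrm{Co}_S^uY\to Y_u$ is an isometric isomorphism.
   Context: $G$ is a locally compact group with a fixed left Haar measure $dx$. $S$ is a Fréchet space and $S^*$ is its conjugate linear dual with the weak topology; $S$ is assumed continuously embedded and weakly dense in $S^*$. The conjugate dual pairing of $\phi\in S^*$ and $v\in S$ is $\langle\phi,v\rangle$ (for $\phi\in S$ it is defined through the embedding $S\subseteq S^*$). $(\pi,S)$ is a continuous representation of $G$ ($g\mapsto\pi(g)v$ is continuous for every $v\in S$), and $\pi^*$ is the representation on $S^*$ given by $\langle\pi^*(x)\phi,v\rangle=\langle\phi,\pi(x^{-1})v\rangle$. For $u\in S$ the voice transform $W_u:S^*\to C(G)$ is $W_u(\phi)(x)=\langle\phi,\pi(x)u\rangle$. Left translation: $\ell_xF(y)=F(x^{-1}y)$. Convolution: $F*H(y)=\int_GF(x)H(x^{-1}y)\,dx$. $Y$ is a left-invariant Banach space of functions on $G$ on which left translation is continuous and such that convergence in $Y$ implies convergence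 (locally) in Haar measure. An analyzing vector for $(S,\pi,Y)$ is a non-zero cyclic vector $u\in S$ (the linear span of $\{\pi(x)u\}_{x\in G}$ is dense in $S$) such that: (R1) $W_u(v)*W_u(u)=W_u(v)$ for all $v\in S$; (R2) $Y\ni F\mapsto\int_GF(x)W_u(u)(x^{-1})\,dx\in\mathbb{C}$ is continuous; (R3) if $F=F*W_u(u)\in Y$ then the mapping $S\ni v\mapsto\int_GF(x)\langle\pi^*(x)u,v\rangle\,dx\in\mathbb{C}$ is in $S^*$; (R4) $S^*\ni\phi\mapsto\int_G\langle\phi,\pi(x)u\rangle\langle\pi^*(x)u,u\rangle\,dx\in\mathbb{C}$ is weakly continuous. $Y_u=\{F\in Y\mid F=F*W_u(u)\}$ with the norm of $Y$. For $F\in Y_u$, $\pi^*(F)u\in S^*$ denotes the functional $v\mapsto\int_GF(x)\langle\pi^*(x)u,v\rangle\,dx$. The coorbit space is $\mathrm{Co}_S^uY=\{\phi\in S^*\mid W_u(\phi)\in Y\}$ with norm $\|\phi\|=\|W_u(\phi)\|_Y$. *)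

theory Defs
  imports "HOL-Analysis.Analysis" "HOL-Library.Function_Algebras"
begin

text \<open>
  The class \<open>group_add\<close> is not commutative, so a topological group is a type of class
  \<open>topological_group_add\<close>: read \<open>x + y\<close> as the product \<open>xy\<close>, \<open>- x\<close> as \<open>x\<^sup>-\<^sup>1\<close> and \<open>0\<close> as the
  identity.
\<close>

text \<open>
  Inner regularity on all Borel sets is the convention under which locally null sets are null;
  it agrees with the outer regular convention if the group is sigma-compact.
\<close>

definition left_haar_measure :: "'g::{topological_group_add,t2_space} measure \<Rightarrow> bool" where
  "left_haar_measure \<mu> \<longleftrightarrow>
     sets \<mu> = sets borel \<and>
     emeasure \<mu> UNIV \<noteq> 0 \<and>
     (\<forall>K. compact K \<longrightarrow> emeasure \<mu> K < \<infinity>) \<and>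
     (\<forall>A\<in>sets borel. emeasure \<mu> A = (SUP K\<in>{K. compact K \<and> K \<subseteq> A}. emeasure \<mu> K)) \<and>
     (\<forall>x. \<forall>A\<in>sets borel. emeasure \<mu> ((+) x ` A) = emeasure \<mu> A)"

abbreviation fun_scale :: "complex \<Rightarrow> ('a \<Rightarrow> complex) \<Rightarrow> 'a \<Rightarrow> complex" where
  "fun_scale c f \<equiv> (\<lambda>x. c * f x)"

definition seminorm_on ::
  "(complex \<Rightarrow> 'v::ab_group_add \<Rightarrow> 'v) \<Rightarrow> 'v set \<Rightarrow> ('v \<Rightarrow> real) \<Rightarrow> bool" where
  "seminorm_on sc V p \<longleftrightarrow>
     (\<forall>v\<in>V. 0 \<le> p v) \<and>
     (\<forall>v\<in>V. \<forall>w\<in>V. p (v + w) \<le> p v + p w) \<and>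
     (\<forall>c. \<forall>v\<in>V. p (sc c v) = cmod c * p v)"

definition seminorm_complete :: "'v::ab_group_add set \<Rightarrow> ('v \<Rightarrow> real) \<Rightarrow> bool" where
  "seminorm_complete V p \<longleftrightarrow>
     (\<forall>f::nat \<Rightarrow> 'v. (\<forall>n. f n \<in> V) \<and>
        (\<forall>e>0. \<exists>k. \<forall>m\<ge>k. \<forall>n\<ge>k. p (f m - f n) < e) \<longrightarrow>
        (\<exists>l\<in>V. (\<lambda>n. p (f n - l)) \<longlonglongrightarrow> 0))"

definition banach_space_on ::
  "(complex \<Rightarrow> 'v::ab_group_add \<Rightarrow> 'v) \<Rightarrow> 'v set \<Rightarrow> ('v \<Rightarrow> real) \<Rightarrow> bool" where
  "banach_space_on sc V p \<longleftrightarrow>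
     module.subspace sc V \<and> seminorm_on sc V p \<and>
     (\<forall>v\<in>V. p v = 0 \<longrightarrow> v = 0) \<and> seminorm_complete V p"

definition seminorm_continuous ::
  "'v::ab_group_add set \<Rightarrow> ('v \<Rightarrow> real) \<Rightarrow> ('w::ab_group_add \<Rightarrow> real) \<Rightarrow> ('v \<Rightarrow> 'w) \<Rightarrow> bool" where
  "seminorm_continuous V p q T \<longleftrightarrow>
     (\<forall>v\<in>V. \<forall>e>0. \<exists>d>0. \<forall>w\<in>V. p (w - v) < d \<longrightarrow> q (T w - T v) < e)"

definition frechet_space ::
  "(complex \<Rightarrow> 's \<Rightarrow> 's::{ab_group_add,topological_space}) \<Rightarrow> bool" where
  "frechet_space sc \<longleftrightarrow> vector_space sc \<and>
     (\<exists>p::nat \<Rightarrow> 's \<Rightarrow> real.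
        (\<forall>n. seminorm_on sc UNIV (p n)) \<and>
        (\<forall>v. (\<forall>n. p n v = 0) \<longrightarrow> v = 0) \<and>
        (\<forall>U. open U \<longleftrightarrow> (\<forall>v\<in>U. \<exists>n. \<exists>e>0. {w. \<forall>i\<le>n. p i (w - v) < e} \<subseteq> U)) \<and>
        (\<forall>f::nat \<Rightarrow> 's.
           (\<forall>i. \<forall>e>0. \<exists>k. \<forall>m\<ge>k. \<forall>n\<ge>k. p i (f m - f n) < e) \<longrightarrow> (\<exists>l. f \<longlonglongrightarrow> l)))"

text \<open>
  The pairing of \<open>\<phi>\<close> in the conjugate dual with \<open>v\<close> is \<open>\<phi> v\<close>. The topology of the type
  \<open>'s \<Rightarrow> complex\<close> is that of pointwise convergence, so it induces the weak topology.
\<close>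

definition conj_dual ::
  "(complex \<Rightarrow> 's \<Rightarrow> 's::{ab_group_add,topological_space}) \<Rightarrow> ('s \<Rightarrow> complex) set" where
  "conj_dual sc = {\<phi>.
     (\<forall>v w. \<phi> (v + w) = \<phi> v + \<phi> w) \<and> (\<forall>c v. \<phi> (sc c v) = cnj c * \<phi> v) \<and>
     continuous_on UNIV \<phi>}"

definition dense_dual_embedding ::
  "(complex \<Rightarrow> 's \<Rightarrow> 's::{ab_group_add,topological_space}) \<Rightarrow> ('s \<Rightarrow> 's \<Rightarrow> complex) \<Rightarrow> bool" where
  "dense_dual_embedding sc \<iota> \<longleftrightarrow>
     range \<iota> \<subseteq> conj_dual sc \<and>
     Vector_Spaces.linear sc fun_scale \<iota> \<and> inj \<iota> \<and>
     continuous_on UNIV \<iota> \<and> conj_dual sc \<subseteq> closure (range \<iota>)"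

definition continuous_representation ::
  "(complex \<Rightarrow> 's \<Rightarrow> 's::{ab_group_add,topological_space}) \<Rightarrow>
   ('g::topological_group_add \<Rightarrow> 's \<Rightarrow> 's) \<Rightarrow> bool" where
  "continuous_representation sc \<pi> \<longleftrightarrow>
     (\<forall>x. Vector_Spaces.linear sc sc (\<pi> x) \<and> continuous_on UNIV (\<pi> x)) \<and>
     \<pi> 0 = id \<and> (\<forall>x y. \<pi> (x + y) = \<pi> x \<circ> \<pi> y) \<and>
     (\<forall>v. continuous_on UNIV (\<lambda>x. \<pi> x v))"

definition contragredient ::
  "('g::group_add \<Rightarrow> 's \<Rightarrow> 's) \<Rightarrow> 'g \<Rightarrow> ('s \<Rightarrow> complex) \<Rightarrow> 's \<Rightarrow> complex" where
  "contragredient \<pi> x \<phi> = (\<lambda>v. \<phi> (\<pi> (- x) v))"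

definition voice ::
  "('g \<Rightarrow> 's \<Rightarrow> 's) \<Rightarrow> 's \<Rightarrow> ('s \<Rightarrow> complex) \<Rightarrow> 'g \<Rightarrow> complex" where
  "voice \<pi> u \<phi> = (\<lambda>x. \<phi> (\<pi> x u))"

definition left_translate :: "'g::group_add \<Rightarrow> ('g \<Rightarrow> complex) \<Rightarrow> 'g \<Rightarrow> complex" where
  "left_translate x F = (\<lambda>y. F (- x + y))"

text \<open>
  The Bochner integral of a non-integrable function is 0, so existence of the convolution is
  a separate predicate.
\<close>

definition convolution ::
  "'g::{group_add,topological_space} measure \<Rightarrow> ('g \<Rightarrow> complex) \<Rightarrow> ('g \<Rightarrow> complex) \<Rightarrow> 'g \<Rightarrow> complex" where
  "convolution \<mu> F H = (\<lambda>y. LINT x|\<mu>. F x * H (- x + y))"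

definition convolution_exists ::
  "'g::{group_add,topological_space} measure \<Rightarrow> ('g \<Rightarrow> complex) \<Rightarrow> ('g \<Rightarrow> complex) \<Rightarrow> bool" where
  "convolution_exists \<mu> F H \<longleftrightarrow> (\<forall>y. integrable \<mu> (\<lambda>x. F x * H (- x + y)))"

text \<open>
  The elements of \<open>Y\<close> are the representatives of a space of a.e. equivalence classes of
  measurable functions; \<open>N\<close> is the norm of the class. Continuity of left translation means
  continuity of each operator \<open>left_translate x\<close> on \<open>Y\<close>; no continuity in \<open>x\<close> is assumed.
\<close>

definition left_invariant_banach_function_space ::
  "'g::{topological_group_add,t2_space} measure \<Rightarrow> ('g \<Rightarrow> complex) set \<Rightarrow>
   (('g \<Rightarrow> complex) \<Rightarrow> real) \<Rightarrow> bool" where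
  "left_invariant_banach_function_space \<mu> Y N \<longleftrightarrow>
     Y \<subseteq> borel_measurable \<mu> \<and>
     (\<forall>F\<in>Y. \<forall>H\<in>borel_measurable \<mu>. (AE x in \<mu>. H x = F x) \<longrightarrow> H \<in> Y) \<and>
     module.subspace fun_scale Y \<and>
     seminorm_on fun_scale Y N \<and>
     (\<forall>F\<in>Y. N F = 0 \<longleftrightarrow> (AE x in \<mu>. F x = 0)) \<and>
     seminorm_complete Y N \<and>
     (\<forall>x. \<forall>F\<in>Y. left_translate x F \<in> Y) \<and>
     (\<forall>x. seminorm_continuous Y N N (left_translate x)) \<and>
     (\<forall>(f::nat \<Rightarrow> 'g \<Rightarrow> complex) F.
        (\<forall>n. f n \<in> Y) \<and> F \<in> Y \<and> (\<lambda>n. N (f n - F)) \<longlonglongrightarrow> 0 \<longrightarrow>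
        (\<forall>K. compact K \<longrightarrow>
           (\<forall>e>0. (\<lambda>n. emeasure \<mu> {x\<in>K. e < cmod (f n x - F x)}) \<longlonglongrightarrow> 0)))"

definition reproducing_space ::
  "'g::{group_add,topological_space} measure \<Rightarrow> ('s \<Rightarrow> 's \<Rightarrow> complex) \<Rightarrow> ('g \<Rightarrow> 's \<Rightarrow> 's) \<Rightarrow>
   ('g \<Rightarrow> complex) set \<Rightarrow> 's \<Rightarrow> ('g \<Rightarrow> complex) set" where
  "reproducing_space \<mu> \<iota> \<pi> Y u = {F\<in>Y.
     convolution_exists \<mu> F (voice \<pi> u (\<iota> u)) \<and>
     (AE x in \<mu>. F x = convolution \<mu> F (voice \<pi> u (\<iota> u)) x)}"

definition integrated_contragredient ::
  "'g::{group_add,topological_space} measure \<Rightarrow> ('g \<Rightarrow> 's \<Rightarrow> 's) \<Rightarrow> ('g \<Rightarrow> complex) \<Rightarrow>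
   ('s \<Rightarrow> complex) \<Rightarrow> 's \<Rightarrow> complex" where
  "integrated_contragredient \<mu> \<pi> F \<phi> = (\<lambda>v. LINT x|\<mu>. F x * contragredient \<pi> x \<phi> v)"

definition analyzing_vector ::
  "'g::{topological_group_add,t2_space} measure \<Rightarrow>
   (complex \<Rightarrow> 's \<Rightarrow> 's::{ab_group_add,topological_space}) \<Rightarrow> ('s \<Rightarrow> 's \<Rightarrow> complex) \<Rightarrow>
   ('g \<Rightarrow> 's \<Rightarrow> 's) \<Rightarrow> ('g \<Rightarrow> complex) set \<Rightarrow> (('g \<Rightarrow> complex) \<Rightarrow> real) \<Rightarrow> 's \<Rightarrow> bool" where
  "analyzing_vector \<mu> sc \<iota> \<pi> Y N u \<longleftrightarrow>
     u \<noteq> 0 \<and>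
     closure (module.span sc (range (\<lambda>x. \<pi> x u))) = UNIV \<and>
     (\<forall>v. convolution_exists \<mu> (voice \<pi> u (\<iota> v)) (voice \<pi> u (\<iota> u)) \<and>
        convolution \<mu> (voice \<pi> u (\<iota> v)) (voice \<pi> u (\<iota> u)) = voice \<pi> u (\<iota> v)) \<and>
     (\<forall>F\<in>Y. integrable \<mu> (\<lambda>x. F x * voice \<pi> u (\<iota> u) (- x))) \<and>
     seminorm_continuous Y N cmod (\<lambda>F. LINT x|\<mu>. F x * voice \<pi> u (\<iota> u) (- x)) \<and>
     (\<forall>F\<in>reproducing_space \<mu> \<iota> \<pi> Y u.
        (\<forall>v. integrable \<mu> (\<lambda>x. F x * contragredient \<pi> x (\<iota> u) v)) \<and>
        integrated_contragredient \<mu> \<pi> F (\<iota> u) \<in> conj_dual sc) \<and>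
     (\<forall>\<phi>\<in>conj_dual sc. integrable \<mu> (\<lambda>x. \<phi> (\<pi> x u) * contragredient \<pi> x (\<iota> u) u)) \<and>
     continuous_on (conj_dual sc) (\<lambda>\<phi>. LINT x|\<mu>. \<phi> (\<pi> x u) * contragredient \<pi> x (\<iota> u) u)"

definition coorbit ::
  "(complex \<Rightarrow> 's \<Rightarrow> 's::{ab_group_add,topological_space}) \<Rightarrow> ('g \<Rightarrow> 's \<Rightarrow> 's) \<Rightarrow>
   ('g \<Rightarrow> complex) set \<Rightarrow> 's \<Rightarrow> ('s \<Rightarrow> complex) set" where
  "coorbit sc \<pi> Y u = {\<phi>\<in>conj_dual sc. voice \<pi> u \<phi> \<in> Y}"

definition coorbit_norm ::
  "('g \<Rightarrow> 's \<Rightarrow> 's) \<Rightarrow> (('g \<Rightarrow> complex) \<Rightarrow> real) \<Rightarrow> 's \<Rightarrow> ('s \<Rightarrow> complex) \<Rightarrow> real" where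
  "coorbit_norm \<pi> N u \<phi> = N (voice \<pi> u \<phi>)"

text \<open>The target \<open>E\<close> consists of representatives, so bijectivity is onto a.e. classes.\<close>

definition isometric_isomorphism_ae ::
  "'g measure \<Rightarrow> (complex \<Rightarrow> 'v::ab_group_add \<Rightarrow> 'v) \<Rightarrow> 'v set \<Rightarrow> ('v \<Rightarrow> real) \<Rightarrow>
   ('g \<Rightarrow> complex) set \<Rightarrow> (('g \<Rightarrow> complex) \<Rightarrow> real) \<Rightarrow> ('v \<Rightarrow> 'g \<Rightarrow> complex) \<Rightarrow> bool" where
  "isometric_isomorphism_ae \<mu> sc V p E q T \<longleftrightarrow>
     (\<forall>v\<in>V. \<forall>w\<in>V. T (v + w) = T v + T w) \<and>
     (\<forall>c. \<forall>v\<in>V. T (sc c v) = fun_scale c (T v)) \<and>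
     T ` V \<subseteq> E \<and>
     (\<forall>v\<in>V. q (T v) = p v) \<and>
     (\<forall>F\<in>E. \<exists>!v. v \<in> V \<and> (AE x in \<mu>. T v x = F x))"

end

theory Submission
  imports Defs
begin

text \<open>
  Write \<open>W\<close> for the voice transform of \<open>u\<close> and \<open>k = W(u)\<close> for the kernel. The proof rests on one
  identity and one density argument. The identity is \<open>F * k = W(\<pi>\<^sup>*(F)u)\<close>
  (\<open>convolution_kernel\<close>), which holds because \<open>\<langle>\<pi>\<^sup>*(x)u, \<pi>(y)u\<rangle> = k(x\<inverse>y)\<close>. It says that
  convolution with \<open>k\<close> is the composition of the synthesis \<open>F \<mapsto> \<pi>\<^sup>*(F)u\<close> with the analysis \<open>W\<close>. The
  density argument (\<open>reproducing_formula\<close>) extends \<open>W(\<phi>) * k = W(\<phi>)\<close> from \<open>S\<close> to all of \<open>S\<^sup>*\<close>, since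
  at each point both sides are weakly continuous in \<open>\<phi>\<close>.

  Given these, analysis and synthesis are inverse to each other. If \<open>F = F * k\<close> almost everywhere
  then \<open>W(\<pi>\<^sup>*(F)u) = F\<close> almost everywhere. If \<open>\<phi>\<close> is in the coorbit space then \<open>\<pi>\<^sup>*(W(\<phi>))u\<close> and
  \<open>\<phi>\<close> have the same transform, so they are equal because \<open>u\<close> is cyclic (\<open>voice_inj\<close>). The
  isometry holds by the definition of the coorbit norm, and the intertwining property is the
  homomorphism law of \<open>\<pi>\<close>.

  Completeness is the analytic part (\<open>coorbit_complete\<close>): the space of \<open>F \<in> Y\<close> with \<open>F = F * k\<close> has
  to be closed under limits of voice transforms. By left invariance \<open>(F * k)(y)\<close> is a fixed
  continuous functional applied to a left translate of \<open>F\<close>, so convolution with \<open>k\<close> turns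
  convergence in \<open>Y\<close> into pointwise convergence. A sequence fixed by the convolution thus has
  the pointwise limit \<open>F * k\<close> and, locally in measure, the limit \<open>F\<close>; the two agree almost
  everywhere (\<open>AE_eq_pointwise_limit_limit_in_measure\<close>).
\<close>

section \<open>Invariance and regularity of Haar measure\<close>

lemma sets_left_haar_measure:
  assumes "left_haar_measure \<mu>"
  shows "sets \<mu> = sets borel"
  using assms unfolding left_haar_measure_def by blast

lemma space_left_haar_measure:
  assumes "left_haar_measure \<mu>"
  shows "space \<mu> = UNIV"
  using sets_eq_imp_space_eq[OF sets_left_haar_measure[OF assms]] by simp

lemma distr_left_haar_measure:
  fixes \<mu> :: "'g::{topological_group_add,t2_space} measure"
  assumes haar: "left_haar_measure \<mu>"
  shows "(+) y \<in> measurable \<mu> \<mu>" and "distr \<mu> \<mu> ((+) y) = \<mu>"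
proof -
  note sets = sets_left_haar_measure[OF haar]
  have "(+) y \<in> borel_measurable borel"
    by (intro borel_measurable_continuous_onI continuous_intros)
  then show meas: "(+) y \<in> measurable \<mu> \<mu>"
    by (simp cong: measurable_cong_sets add: sets)
  show "distr \<mu> \<mu> ((+) y) = \<mu>"
  proof (rule measure_eqI)
    fix A assume "A \<in> sets (distr \<mu> \<mu> ((+) y))"
    then have A: "A \<in> sets \<mu>" by simp
    have "(+) y -` A = (+) (- y) ` A"
    proof (intro set_eqI iffI)
      fix x assume "x \<in> (+) y -` A"
      then show "x \<in> (+) (- y) ` A"
        by (intro image_eqI[of _ _ "y + x"]) (auto simp: add.assoc[symmetric])
    qed (auto simp: add.assoc[symmetric])
    moreover have "emeasure \<mu> ((+) (- y) ` A) = emeasure \<mu> A"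
      using haar A unfolding left_haar_measure_def by auto
    ultimately show "emeasure (distr \<mu> \<mu> ((+) y)) A = emeasure \<mu> A"
      using A by (simp add: emeasure_distr[OF meas] space_left_haar_measure[OF haar])
  qed simp
qed

lemma integral_left_translation:
  fixes \<mu> :: "'g::{topological_group_add,t2_space} measure" and f :: "'g \<Rightarrow> complex"
  assumes haar: "left_haar_measure \<mu>" and f: "integrable \<mu> f"
  shows "integrable \<mu> (\<lambda>x. f (y + x))" and "(LINT x|\<mu>. f (y + x)) = (LINT x|\<mu>. f x)"
proof -
  note meas = distr_left_haar_measure(1)[OF haar, of y]
  note distr = distr_left_haar_measure(2)[OF haar, of y]
  have fm: "f \<in> borel_measurable \<mu>" using f by simp
  show "integrable \<mu> (\<lambda>x. f (y + x))"
    using integrable_distr_eq[OF meas fm] f by (simp add: distr)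
  show "(LINT x|\<mu>. f (y + x)) = (LINT x|\<mu>. f x)"
    using integral_distr[OF meas fm] by (simp add: distr)
qed

text \<open>
  In \<open>\<integral> F(x) H(x\<inverse>y) dx\<close> replace \<open>x\<close> by \<open>yx\<close>: a convolution at \<open>y\<close> is the pairing with
  \<open>x \<mapsto> H(x\<inverse>)\<close> of a left translate. Continuity of that single pairing therefore controls the
  convolution at every point.
\<close>

lemma convolution_as_pairing:
  fixes \<mu> :: "'g::{topological_group_add,t2_space} measure"
  assumes haar: "left_haar_measure \<mu>"
    and int: "integrable \<mu> (\<lambda>x. F (y + x) * H (- x))"
  shows "integrable \<mu> (\<lambda>x. F x * H (- x + y))"
    and "convolution \<mu> F H y = (LINT x|\<mu>. F (y + x) * H (- x))"
proof -
  have eq: "- (- y + x) = - x + y" for x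
    by (simp add: minus_add)
  show "integrable \<mu> (\<lambda>x. F x * H (- x + y))"
    using integral_left_translation(1)[OF haar int, of "- y"]
    by (simp add: eq add.assoc[symmetric])
  show "convolution \<mu> F H y = (LINT x|\<mu>. F (y + x) * H (- x))"
    using integral_left_translation(2)[OF haar int, of "- y"]
    by (simp add: eq add.assoc[symmetric] convolution_def)
qed

text \<open>
  On a compact set the two limits agree almost everywhere: let \<open>e > 0\<close>; where they
  differ by more than \<open>2e\<close> and the pointwise limit is reached up to \<open>e\<close> from index \<open>m\<close> on, the
  sequence stays further than \<open>e\<close> from the limit in measure, so this set is null. Inner
  regularity passes from compact sets to the whole group, which need not be sigma-compact.
\<close>

lemma AE_eq_pointwise_limit_limit_in_measure:
  fixes \<mu> :: "'g::{topological_group_add,t2_space} measure"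
    and f :: "nat \<Rightarrow> 'g \<Rightarrow> complex"
  assumes haar: "left_haar_measure \<mu>"
    and fm: "\<And>n. f n \<in> borel_measurable \<mu>" and Fm: "F \<in> borel_measurable \<mu>"
    and ptw: "\<And>x. (\<lambda>n. f n x) \<longlonglongrightarrow> g x"
    and meas: "\<And>K e. compact K \<Longrightarrow> 0 < e \<Longrightarrow>
      (\<lambda>n. emeasure \<mu> {x\<in>K. e < cmod (f n x - F x)}) \<longlonglongrightarrow> 0"
  shows "AE x in \<mu>. F x = g x"
proof -
  note sets = sets_left_haar_measure[OF haar]
  note space = space_left_haar_measure[OF haar]
  have gm: "g \<in> borel_measurable \<mu>"
    by (rule borel_measurable_LIMSEQ_metric[OF fm ptw])
  note [measurable] = fm Fm gm
  define A where "A = {x. F x \<noteq> g x}"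
  have "{x \<in> space \<mu>. F x \<noteq> g x} \<in> sets \<mu>" by measurable
  then have A: "A \<in> sets \<mu>" by (simp add: A_def space)
  have "emeasure \<mu> K = 0" if K: "compact K" "K \<subseteq> A" for K
  proof -
    have Ks [measurable]: "K \<in> sets \<mu>"
      using K(1) by (simp add: sets compact_imp_closed)
    \<comment> \<open>Points where the limits differ by more than \<open>2e\<close> and \<open>f\<close> is within \<open>e\<close> of \<open>g\<close> from index
      \<open>m\<close> on, for \<open>e = 1 / (k + 1)\<close>.\<close>
    define B where
      "B k m = {x \<in> K. 2 / real (Suc k) < cmod (F x - g x) \<and>
         (\<forall>n\<ge>m. cmod (f n x - g x) \<le> 1 / real (Suc k))}" for k m :: nat
    have Bs: "B k m \<in> sets \<mu>" for k m
    proof -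
      have "{x \<in> space \<mu>. x \<in> K \<and> 2 / real (Suc k) < cmod (F x - g x) \<and>
         (\<forall>n\<ge>m. cmod (f n x - g x) \<le> 1 / real (Suc k))} \<in> sets \<mu>"
        by measurable
      then show ?thesis by (simp add: B_def space)
    qed
    have B0: "B k m \<in> null_sets \<mu>" for k m
    proof -
      have le: "emeasure \<mu> (B k m) \<le>
          emeasure \<mu> {x\<in>K. 1 / real (Suc k) < cmod (f n x - F x)}" if "n \<ge> m" for n
      proof (rule emeasure_mono)
        show "B k m \<subseteq> {x\<in>K. 1 / real (Suc k) < cmod (f n x - F x)}"
        proof
          fix x assume "x \<in> B k m"
          then have x: "x \<in> K" "2 / real (Suc k) < cmod (F x - g x)"
            "cmod (f n x - g x) \<le> 1 / real (Suc k)"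
            using that by (auto simp: B_def)
          have "cmod (F x - g x) \<le> cmod (f n x - F x) + cmod (f n x - g x)"
            using norm_triangle_ineq4[of "f n x - g x" "f n x - F x"] by simp
          moreover have "2 / real (Suc k) = 1 / real (Suc k) + 1 / real (Suc k)" by simp
          ultimately show "x \<in> {x\<in>K. 1 / real (Suc k) < cmod (f n x - F x)}"
            using x by simp
        qed
        have "{x \<in> space \<mu>. x \<in> K \<and> 1 / real (Suc k) < cmod (f n x - F x)} \<in> sets \<mu>"
          by measurable
        then show "{x\<in>K. 1 / real (Suc k) < cmod (f n x - F x)} \<in> sets \<mu>"
          by (simp add: space)
      qed
      have "emeasure \<mu> (B k m) \<le> 0"
        by (rule LIMSEQ_le_const[OF meas[OF K(1)], of "1 / real (Suc k)"]) (use le in auto)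
      then show ?thesis using Bs by auto
    qed
    have "K \<subseteq> (\<Union>k. \<Union>m. B k m)"
    proof
      fix x assume x: "x \<in> K"
      then have "0 < cmod (F x - g x) / 2" using K(2) by (auto simp: A_def)
      then obtain k where k: "inverse (real (Suc k)) < cmod (F x - g x) / 2"
        using reals_Archimedean by blast
      have "\<forall>\<^sub>F n in sequentially. dist (f n x) (g x) < 1 / real (Suc k)"
        by (rule tendstoD[OF ptw]) simp
      then obtain m where "\<And>n. n \<ge> m \<Longrightarrow> cmod (f n x - g x) < 1 / real (Suc k)"
        by (auto simp: eventually_sequentially dist_norm)
      then have "x \<in> B k m" using x k by (auto simp: B_def field_simps less_imp_le)
      then show "x \<in> (\<Union>k. \<Union>m. B k m)" by blast
    qed
    moreover have "(\<Union>k. \<Union>m. B k m) \<in> null_sets \<mu>"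
      using B0 by (intro null_sets_UN) auto
    ultimately have "K \<in> null_sets \<mu>" using Ks null_sets_subset by blast
    then show ?thesis by auto
  qed
  moreover have "emeasure \<mu> A = (SUP K\<in>{K. compact K \<and> K \<subseteq> A}. emeasure \<mu> K)"
    using haar A unfolding left_haar_measure_def by auto
  ultimately have "emeasure \<mu> A = 0" by (auto intro!: SUP_eq_const)
  then have "A \<in> null_sets \<mu>" using A by auto
  then show ?thesis by (rule AE_I') (auto simp: A_def)
qed

section \<open>Density arguments\<close>

lemma continuous_on_eq_if_eq_on_dense:
  fixes f g :: "'a::topological_space \<Rightarrow> complex"
  assumes f: "continuous_on D f" and g: "continuous_on D g"
    and R: "R \<subseteq> D" "D \<subseteq> closure R" and eq: "\<And>x. x \<in> R \<Longrightarrow> f x = g x" and x: "x \<in> D"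
  shows "f x = g x"
proof (rule ccontr)
  assume ne: "f x \<noteq> g x"
  have "continuous_on D (\<lambda>x. f x - g x)" using f g by (intro continuous_intros)
  then obtain U where U: "open U" "U \<inter> D = (\<lambda>x. f x - g x) -` (- {0}) \<inter> D"
    by (metis continuous_on_open_invariant open_delete Compl_eq_Diff_UNIV open_UNIV)
  have "x \<in> U" using U(2) ne x by auto
  then obtain r where "r \<in> U" "r \<in> R"
    using U(1) x R(2) open_Int_closure_eq_empty[of U R] by blast
  then show False using U(2) R(1) eq[of r] by auto
qed

lemma module_fun_scale: "module (fun_scale :: complex \<Rightarrow> ('a \<Rightarrow> complex) \<Rightarrow> _)"
  by unfold_locales (auto simp: fun_eq_iff plus_fun_def algebra_simps)

lemma conj_dual_subspace: "module.subspace fun_scale (conj_dual sc)"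
  unfolding module.subspace_def[OF module_fun_scale] conj_dual_def
  by (auto simp: plus_fun_def zero_fun_def algebra_simps intro!: continuous_intros)

lemma conj_dual_diff:
  assumes "\<phi> \<in> conj_dual sc" "\<psi> \<in> conj_dual sc"
  shows "\<phi> - \<psi> \<in> conj_dual sc"
  by (rule module.subspace_diff[OF module_fun_scale conj_dual_subspace assms])

lemma voice_add: "voice \<pi> u (\<phi> + \<psi>) = voice \<pi> u \<phi> + voice \<pi> u \<psi>"
  by (simp add: voice_def plus_fun_def)

lemma voice_diff: "voice \<pi> u (\<phi> - \<psi>) = voice \<pi> u \<phi> - voice \<pi> u \<psi>"
  by (simp add: voice_def fun_eq_iff)

lemma voice_scale: "voice \<pi> u (fun_scale c \<phi>) = fun_scale c (voice \<pi> u \<phi>)"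
  by (simp add: voice_def)

lemma contragredient_in_conj_dual:
  assumes \<pi>: "continuous_representation sc \<pi>" and \<phi>: "\<phi> \<in> conj_dual sc"
  shows "contragredient \<pi> x \<phi> \<in> conj_dual sc"
proof -
  have lin: "Vector_Spaces.linear sc sc (\<pi> (- x))" and cont: "continuous_on UNIV (\<pi> (- x))"
    using \<pi> unfolding continuous_representation_def by auto
  have "continuous_on UNIV (\<lambda>v. \<phi> (\<pi> (- x) v))"
    using \<phi> cont unfolding conj_dual_def by (auto intro: continuous_on_compose2)
  moreover have "\<pi> (- x) (v + w) = \<pi> (- x) v + \<pi> (- x) w" for v w
    by (rule module_hom.add[OF module_hom_iff_linear[THEN iffD2, OF lin]])
  moreover have "\<pi> (- x) (sc c v) = sc c (\<pi> (- x) v)" for c v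
    by (rule module_hom.scale[OF module_hom_iff_linear[THEN iffD2, OF lin]])
  ultimately show ?thesis
    using \<phi> unfolding conj_dual_def contragredient_def by auto
qed

lemma voice_contragredient:
  assumes "continuous_representation sc \<pi>"
  shows "voice \<pi> u (contragredient \<pi> y \<phi>) = left_translate y (voice \<pi> u \<phi>)"
  using assms
  by (auto simp: continuous_representation_def voice_def contragredient_def left_translate_def)

text \<open>
  Additivity and conjugate homogeneity carry the equality from the orbit of \<open>u\<close> to its span, and
  continuity carries it from the span to its closure.
\<close>

lemma voice_inj:
  assumes sc: "vector_space sc"
    and cyclic: "closure (module.span sc (range (\<lambda>x. \<pi> x u))) = UNIV"
    and \<phi>: "\<phi> \<in> conj_dual sc" and \<psi>: "\<psi> \<in> conj_dual sc"
    and eq: "voice \<pi> u \<phi> = voice \<pi> u \<psi>"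
  shows "\<phi> = \<psi>"
proof -
  interpret vector_space sc by (fact sc)
  have add: "\<phi> (v + w) = \<phi> v + \<phi> w" "\<psi> (v + w) = \<psi> v + \<psi> w" for v w
    using \<phi> \<psi> by (auto simp: conj_dual_def)
  have sc: "\<phi> (sc c v) = cnj c * \<phi> v" "\<psi> (sc c v) = cnj c * \<psi> v" for c v
    using \<phi> \<psi> by (auto simp: conj_dual_def)
  have cont: "continuous_on UNIV \<phi>" "continuous_on UNIV \<psi>"
    using \<phi> \<psi> by (auto simp: conj_dual_def)
  have "\<phi> 0 = \<psi> 0" using sc[of 0 0] by simp
  then have sub: "subspace {v. \<phi> v = \<psi> v}"
    by (auto simp: subspace_def add sc)
  have "span (range (\<lambda>x. \<pi> x u)) \<subseteq> {v. \<phi> v = \<psi> v}"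
    by (rule span_minimal[OF _ sub]) (use eq in \<open>auto simp: voice_def fun_eq_iff\<close>)
  then have eq: "\<phi> v = \<psi> v" if "v \<in> span (range (\<lambda>x. \<pi> x u))" for v
    using that by blast
  have dense: "UNIV \<subseteq> closure (span (range (\<lambda>x. \<pi> x u)))"
    by (simp only: cyclic order_refl)
  have "\<phi> v = \<psi> v" for v
    by (rule continuous_on_eq_if_eq_on_dense[OF cont subset_UNIV dense eq UNIV_I])
  then show ?thesis by blast
qed

section \<open>The coorbit space of an analyzing vector\<close>

locale coorbit_setting =
  fixes \<mu> :: "'g::{topological_group_add,t2_space} measure"
    and sc :: "complex \<Rightarrow> 's \<Rightarrow> 's::{ab_group_add,topological_space}"
    and \<iota> :: "'s \<Rightarrow> 's \<Rightarrow> complex"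
    and \<pi> :: "'g \<Rightarrow> 's \<Rightarrow> 's"
    and Y :: "('g \<Rightarrow> complex) set"
    and N :: "('g \<Rightarrow> complex) \<Rightarrow> real"
    and u :: 's
  assumes haar: "left_haar_measure \<mu>"
    and frechet: "frechet_space sc"
    and embedding: "dense_dual_embedding sc \<iota>"
    and rep: "continuous_representation sc \<pi>"
    and space_Y: "left_invariant_banach_function_space \<mu> Y N"
    and analyzing: "analyzing_vector \<mu> sc \<iota> \<pi> Y N u"
begin

abbreviation W :: "('s \<Rightarrow> complex) \<Rightarrow> 'g \<Rightarrow> complex" where "W \<equiv> voice \<pi> u"

abbreviation kernel :: "'g \<Rightarrow> complex" where "kernel \<equiv> W (\<iota> u)"

lemma rep_add: "\<pi> (x + y) v = \<pi> x (\<pi> y v)"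
  using rep by (simp add: continuous_representation_def)

lemma kernel_eq: "kernel (- x + y) = contragredient \<pi> x (\<iota> u) (\<pi> y u)"
  by (simp add: voice_def contragredient_def rep_add)

text \<open>
  By \<open>kernel_eq\<close> the integrand of the convolution at \<open>y\<close> is that of the functional \<open>\<pi>\<^sup>*(F)u\<close> at
  \<open>\<pi>(y)u\<close>.
\<close>

lemma convolution_kernel: "convolution \<mu> F kernel = W (integrated_contragredient \<mu> \<pi> F (\<iota> u))"
  by (rule ext, subst voice_def)
    (simp add: convolution_def integrated_contragredient_def kernel_eq)

lemma borel_measurable_voice:
  assumes "\<phi> \<in> conj_dual sc"
  shows "W \<phi> \<in> borel_measurable \<mu>"
proof -
  have "continuous_on UNIV (\<lambda>x. \<phi> (\<pi> x u))"
    using assms rep unfolding conj_dual_def continuous_representation_def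
    by (auto intro: continuous_on_compose2)
  then have "W \<phi> \<in> borel_measurable borel"
    unfolding voice_def by (rule borel_measurable_continuous_onI)
  then show ?thesis
    by (simp cong: measurable_cong_sets add: sets_left_haar_measure[OF haar])
qed

lemma cyclic: "closure (module.span sc (range (\<lambda>x. \<pi> x u))) = UNIV"
  and reproducing_formula_embedded: "convolution \<mu> (W (\<iota> v)) kernel = W (\<iota> v)"
  and integrable_times_kernel: "F \<in> Y \<Longrightarrow> integrable \<mu> (\<lambda>x. F x * kernel (- x))"
  and pairing_kernel_continuous: "seminorm_continuous Y N cmod (\<lambda>F. LINT x|\<mu>. F x * kernel (- x))"
  and integrated_contragredient_in_conj_dual: "F \<in> reproducing_space \<mu> \<iota> \<pi> Y u \<Longrightarrow>
    integrated_contragredient \<mu> \<pi> F (\<iota> u) \<in> conj_dual sc"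
  and integrable_voice_times_kernel: "\<phi> \<in> conj_dual sc \<Longrightarrow>
    integrable \<mu> (\<lambda>x. \<phi> (\<pi> x u) * contragredient \<pi> x (\<iota> u) u)"
  and pairing_kernel_weakly_continuous: "continuous_on (conj_dual sc)
    (\<lambda>\<phi>. LINT x|\<mu>. \<phi> (\<pi> x u) * contragredient \<pi> x (\<iota> u) u)"
proof -
  note a = analyzing[unfolded analyzing_vector_def]
  show "closure (module.span sc (range (\<lambda>x. \<pi> x u))) = UNIV" using a by (elim conjE)
  show "convolution \<mu> (W (\<iota> v)) kernel = W (\<iota> v)"
    using a by (elim conjE) (erule allE, erule conjE)
  show "F \<in> Y \<Longrightarrow> integrable \<mu> (\<lambda>x. F x * kernel (- x))"
    using a by (elim conjE) (erule bspec)
  show "seminorm_continuous Y N cmod (\<lambda>F. LINT x|\<mu>. F x * kernel (- x))"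
    using a by (elim conjE)
  show "F \<in> reproducing_space \<mu> \<iota> \<pi> Y u \<Longrightarrow>
      integrated_contragredient \<mu> \<pi> F (\<iota> u) \<in> conj_dual sc"
    using a by (elim conjE) (drule (1) bspec, erule conjE)
  show "\<phi> \<in> conj_dual sc \<Longrightarrow>
      integrable \<mu> (\<lambda>x. \<phi> (\<pi> x u) * contragredient \<pi> x (\<iota> u) u)"
    using a by (elim conjE) (erule bspec)
  show "continuous_on (conj_dual sc)
      (\<lambda>\<phi>. LINT x|\<mu>. \<phi> (\<pi> x u) * contragredient \<pi> x (\<iota> u) u)"
    using a by (elim conjE)
qed

lemma voice_eq_imp_eq:
  assumes "\<phi> \<in> conj_dual sc" and "\<psi> \<in> conj_dual sc" and "W \<phi> = W \<psi>"
  shows "\<phi> = \<psi>"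
proof (rule voice_inj[OF _ cyclic assms])
  show "vector_space sc" using frechet unfolding frechet_space_def by (rule conjunct1)
qed

text \<open>
  The reproducing formula holds on \<open>S\<close> by assumption. At a point \<open>y\<close> both of its sides are weakly
  continuous in \<open>\<phi>\<close>: the left side is the weakly continuous functional
  \<open>\<phi> \<mapsto> \<integral> \<langle>\<phi>, \<pi>(x)u\<rangle> \<langle>\<pi>\<^sup>*(x)u, u\<rangle> dx\<close> evaluated at \<open>\<pi>\<^sup>*(y\<inverse>)\<phi>\<close>. As \<open>S\<close> is
  weakly dense, the formula extends to all of \<open>S\<^sup>*\<close>.
\<close>

lemma reproducing_formula:
  assumes "\<phi> \<in> conj_dual sc"
  shows "convolution_exists \<mu> (W \<phi>) kernel" and "convolution \<mu> (W \<phi>) kernel = W \<phi>"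
proof -
  define G where "G \<phi> = (LINT x|\<mu>. \<phi> (\<pi> x u) * contragredient \<pi> x (\<iota> u) u)" for \<phi>
  note G_cont = pairing_kernel_weakly_continuous[folded G_def]
  have ex: "integrable \<mu> (\<lambda>x. W \<psi> x * kernel (- x + y))"
    and conv: "convolution \<mu> (W \<psi>) kernel y = G (contragredient \<pi> (- y) \<psi>)"
    if "\<psi> \<in> conj_dual sc" for \<psi> y
  proof -
    have eq: "contragredient \<pi> (- y) \<psi> (\<pi> x u) * contragredient \<pi> x (\<iota> u) u =
        W \<psi> (y + x) * kernel (- x)" for x
      by (simp add: voice_def contragredient_def rep_add)
    have "integrable \<mu> (\<lambda>x. W \<psi> (y + x) * kernel (- x))"
      using integrable_voice_times_kernel[OF contragredient_in_conj_dual[OF rep that, of "- y"]]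
      by (simp add: eq)
    note pairing = convolution_as_pairing[where H = kernel, OF haar this]
    show "integrable \<mu> (\<lambda>x. W \<psi> x * kernel (- x + y))" by (fact pairing)
    show "convolution \<mu> (W \<psi>) kernel y = G (contragredient \<pi> (- y) \<psi>)"
      unfolding G_def eq by (fact pairing)
  qed
  show "convolution_exists \<mu> (W \<phi>) kernel"
    using ex[OF assms] by (simp add: convolution_exists_def)
  show "convolution \<mu> (W \<phi>) kernel = W \<phi>"
  proof
    fix y
    have range: "range \<iota> \<subseteq> conj_dual sc" and dense: "conj_dual sc \<subseteq> closure (range \<iota>)"
      using embedding by (auto simp: dense_dual_embedding_def)
    have "continuous_on UNIV (contragredient \<pi> (- y))"
      unfolding contragredient_def
      by (rule continuous_on_coordinatewise_then_product) (rule continuous_on_product_coordinates)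
    then have "continuous_on (conj_dual sc) (contragredient \<pi> (- y))"
      by (rule continuous_on_subset) simp
    then have left: "continuous_on (conj_dual sc) (\<lambda>\<psi>. G (contragredient \<pi> (- y) \<psi>))"
      by (rule continuous_on_compose2[OF G_cont])
        (blast intro: contragredient_in_conj_dual[OF rep])
    have right: "continuous_on (conj_dual sc) (\<lambda>\<psi>. W \<psi> y)"
      unfolding voice_def
      by (rule continuous_on_subset[OF continuous_on_product_coordinates subset_UNIV])
    have eq: "G (contragredient \<pi> (- y) \<psi>) = W \<psi> y" if "\<psi> \<in> range \<iota>" for \<psi>
    proof -
      from that obtain v where v: "\<psi> = \<iota> v" by blast
      have "convolution \<mu> (W \<psi>) kernel = W \<psi>" unfolding v by (rule reproducing_formula_embedded)
      then show ?thesis using conv[OF subsetD[OF range that], of y] by metis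
    qed
    have "G (contragredient \<pi> (- y) \<phi>) = W \<phi> y"
      by (rule continuous_on_eq_if_eq_on_dense[OF left right range dense eq assms])
    then show "convolution \<mu> (W \<phi>) kernel y = W \<phi> y"
      using conv[OF assms] by simp
  qed
qed

text \<open>
  The reproducing formula turns equality almost everywhere into equality everywhere, because a
  convolution depends only on the class of its first factor.
\<close>

lemma AE_voice_eq_imp_eq:
  assumes \<phi>: "\<phi> \<in> conj_dual sc" and \<psi>: "\<psi> \<in> conj_dual sc" and ae: "AE x in \<mu>. W \<phi> x = W \<psi> x"
  shows "\<phi> = \<psi>"
proof -
  note \<chi> = conj_dual_diff[OF \<phi> \<psi>]
  have "W (\<phi> - \<psi>) y = W 0 y" for y
  proof -
    have "W (\<phi> - \<psi>) y = convolution \<mu> (W (\<phi> - \<psi>)) kernel y"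
      using reproducing_formula(2)[OF \<chi>] by simp
    also have "\<dots> = 0"
      unfolding convolution_def
      by (rule integral_eq_zero_AE) (use ae in \<open>auto simp: voice_diff\<close>)
    finally show ?thesis by (simp add: voice_def)
  qed
  then have "\<phi> - \<psi> = 0"
    by (intro voice_eq_imp_eq \<chi>)
      (auto simp: module.subspace_0[OF module_fun_scale conj_dual_subspace])
  then show ?thesis by simp
qed

lemma Y_measurable: "F \<in> Y \<Longrightarrow> F \<in> borel_measurable \<mu>"
  and Y_AE_cong: "F \<in> Y \<Longrightarrow> H \<in> borel_measurable \<mu> \<Longrightarrow> (AE x in \<mu>. H x = F x) \<Longrightarrow> H \<in> Y"
  and Y_subspace: "module.subspace fun_scale Y"
  and Y_seminorm: "seminorm_on fun_scale Y N"
  and Y_norm_0: "F \<in> Y \<Longrightarrow> N F = 0 \<longleftrightarrow> (AE x in \<mu>. F x = 0)"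
  and Y_complete: "seminorm_complete Y N"
  and Y_translate: "F \<in> Y \<Longrightarrow> left_translate x F \<in> Y"
  and Y_translate_continuous: "seminorm_continuous Y N N (left_translate x)"
  and Y_local_measure: "(\<And>n. f n \<in> Y) \<Longrightarrow> F \<in> Y \<Longrightarrow> (\<lambda>n. N (f n - F)) \<longlonglongrightarrow> 0 \<Longrightarrow> compact K \<Longrightarrow>
      0 < e \<Longrightarrow> (\<lambda>n. emeasure \<mu> {x\<in>K. e < cmod (f n x - F x)}) \<longlonglongrightarrow> 0"
proof -
  note y = space_Y[unfolded left_invariant_banach_function_space_def]
  show "F \<in> borel_measurable \<mu>" if "F \<in> Y"
    using y[THEN conjunct1] that by blast
  note y = y[THEN conjunct2]
  show "H \<in> Y" if "F \<in> Y" "H \<in> borel_measurable \<mu>" "AE x in \<mu>. H x = F x"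
    by (rule y[THEN conjunct1, rule_format, OF that])
  note y = y[THEN conjunct2]
  show "module.subspace fun_scale Y" by (rule y[THEN conjunct1])
  note y = y[THEN conjunct2]
  show "seminorm_on fun_scale Y N" by (rule y[THEN conjunct1])
  note y = y[THEN conjunct2]
  show "N F = 0 \<longleftrightarrow> (AE x in \<mu>. F x = 0)" if "F \<in> Y"
    by (rule y[THEN conjunct1, rule_format, OF that])
  note y = y[THEN conjunct2]
  show "seminorm_complete Y N" by (rule y[THEN conjunct1])
  note y = y[THEN conjunct2]
  show "left_translate x F \<in> Y" if "F \<in> Y"
    by (rule y[THEN conjunct1, rule_format, OF that])
  note y = y[THEN conjunct2]
  show "seminorm_continuous Y N N (left_translate x)"
    by (rule y[THEN conjunct1, rule_format])
  show "(\<lambda>n. emeasure \<mu> {x\<in>K. e < cmod (f n x - F x)}) \<longlonglongrightarrow> 0"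
    if "\<And>n. f n \<in> Y" "F \<in> Y" "(\<lambda>n. N (f n - F)) \<longlonglongrightarrow> 0" "compact K" "0 < e"
    by (rule y[THEN conjunct2, rule_format, OF _ that(4,5)]) (use that in simp)
qed

lemmas Y_diff = module.subspace_diff[OF module_fun_scale Y_subspace]

lemma integrated_contragredient_in_coorbit:
  assumes F: "F \<in> reproducing_space \<mu> \<iota> \<pi> Y u"
  defines "\<phi> \<equiv> integrated_contragredient \<mu> \<pi> F (\<iota> u)"
  shows "\<phi> \<in> coorbit sc \<pi> Y u" and "AE x in \<mu>. W \<phi> x = F x"
proof -
  have \<phi>: "\<phi> \<in> conj_dual sc"
    unfolding \<phi>_def by (rule integrated_contragredient_in_conj_dual[OF F])
  have FY: "F \<in> Y" and "AE x in \<mu>. F x = W \<phi> x"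
    using F unfolding reproducing_space_def convolution_kernel \<phi>_def by auto
  then show ae: "AE x in \<mu>. W \<phi> x = F x" by auto
  show "\<phi> \<in> coorbit sc \<pi> Y u"
    using Y_AE_cong[OF FY borel_measurable_voice[OF \<phi>] ae] \<phi> by (simp add: coorbit_def)
qed

lemma voice_in_reproducing_space:
  assumes "\<phi> \<in> coorbit sc \<pi> Y u"
  shows "W \<phi> \<in> reproducing_space \<mu> \<iota> \<pi> Y u"
  using assms reproducing_formula[of \<phi>] by (simp add: coorbit_def reproducing_space_def)

lemma integrated_contragredient_voice:
  assumes "\<phi> \<in> coorbit sc \<pi> Y u"
  shows "integrated_contragredient \<mu> \<pi> (W \<phi>) (\<iota> u) = \<phi>"
proof -
  have "\<phi> \<in> conj_dual sc" using assms by (simp add: coorbit_def)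
  then show ?thesis
    using integrated_contragredient_in_coorbit(1)[OF voice_in_reproducing_space[OF assms]]
    by (intro voice_eq_imp_eq)
      (auto simp: coorbit_def convolution_kernel[symmetric] reproducing_formula(2))
qed

lemma coorbit_eq_image:
  "coorbit sc \<pi> Y u =
    (\<lambda>F. integrated_contragredient \<mu> \<pi> F (\<iota> u)) ` reproducing_space \<mu> \<iota> \<pi> Y u"
proof (intro set_eqI iffI)
  fix \<phi> assume \<phi>: "\<phi> \<in> coorbit sc \<pi> Y u"
  show "\<phi> \<in> (\<lambda>F. integrated_contragredient \<mu> \<pi> F (\<iota> u)) ` reproducing_space \<mu> \<iota> \<pi> Y u"
    by (rule image_eqI[where x = "W \<phi>"])
      (simp_all add: integrated_contragredient_voice[OF \<phi>] voice_in_reproducing_space[OF \<phi>])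
qed (auto intro: integrated_contragredient_in_coorbit)

lemma integrable_translate_times_kernel:
  assumes "F \<in> Y"
  shows "integrable \<mu> (\<lambda>x. F (y + x) * kernel (- x))"
  using integrable_times_kernel[OF Y_translate[OF assms, of "- y"]]
  by (simp add: left_translate_def)

lemma convolution_exists_kernel: "F \<in> Y \<Longrightarrow> convolution_exists \<mu> F kernel"
  unfolding convolution_exists_def
  by (intro allI convolution_as_pairing(1)[OF haar] integrable_translate_times_kernel)

text \<open>
  Evaluation of \<open>F * W\<^sub>u(u)\<close> at \<open>y\<close> is the left translation of \<open>F\<close> by \<open>y\<inverse>\<close> followed by the pairing
  \<open>F \<mapsto> \<integral> F(x) W\<^sub>u(u)(x\<inverse>) dx\<close>, and both of these maps are continuous on \<open>Y\<close>.
\<close>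

lemma convolution_kernel_continuous:
  assumes fY: "\<And>n. f n \<in> Y" and FY: "F \<in> Y" and lim: "(\<lambda>n. N (f n - F)) \<longlonglongrightarrow> 0"
  shows "(\<lambda>n. convolution \<mu> (f n) kernel y) \<longlonglongrightarrow> convolution \<mu> F kernel y"
proof -
  define L where "L F = (LINT x|\<mu>. F x * kernel (- x))" for F
  note L = pairing_kernel_continuous[folded L_def]
  have conv: "convolution \<mu> H kernel y = L (left_translate (- y) H)" if "H \<in> Y" for H
    using convolution_as_pairing(2)[OF haar integrable_translate_times_kernel[OF that]]
    by (simp add: L_def left_translate_def)
  have "(\<lambda>n. L (left_translate (- y) (f n))) \<longlonglongrightarrow> L (left_translate (- y) F)"
  proof (rule LIMSEQ_I)
    fix e :: real assume "0 < e"
    then obtain d where d: "d > 0" "\<And>H. H \<in> Y \<Longrightarrow> N (H - left_translate (- y) F) < d \<Longrightarrow>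
        cmod (L H - L (left_translate (- y) F)) < e"
      using L Y_translate[OF FY, of "- y"] unfolding seminorm_continuous_def by meson
    then obtain d' where d': "d' > 0" "\<And>H. H \<in> Y \<Longrightarrow> N (H - F) < d' \<Longrightarrow>
        N (left_translate (- y) H - left_translate (- y) F) < d"
      using Y_translate_continuous[of "- y"] FY unfolding seminorm_continuous_def by meson
    have "\<forall>\<^sub>F n in sequentially. N (f n - F) < d'"
      using order_tendstoD(2)[OF lim d'(1)] .
    then show "\<exists>n0. \<forall>n\<ge>n0. cmod (L (left_translate (- y) (f n)) - L (left_translate (- y) F)) < e"
      using d(2) d'(2) fY Y_translate unfolding eventually_sequentially by meson
  qed
  then show ?thesis
    using conv fY FY by simp
qed

lemma coorbit_subspace: "module.subspace fun_scale (coorbit sc \<pi> Y u)"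
proof -
  have "W 0 = 0" by (simp add: voice_def zero_fun_def)
  then show ?thesis
    using conj_dual_subspace[of sc] Y_subspace
    unfolding module.subspace_def[OF module_fun_scale] coorbit_def
    by (auto simp: voice_add voice_scale)
qed

text \<open>
  The limit \<open>F\<close> in \<open>Y\<close> of a Cauchy sequence of voice transforms satisfies \<open>F = F * W\<^sub>u(u)\<close>: the
  sequence is fixed by the convolution, so it converges to \<open>F * W\<^sub>u(u)\<close> at every point, and
  it converges to \<open>F\<close> locally in measure. Synthesis of \<open>F\<close> then gives the limit.
\<close>

lemma coorbit_complete: "seminorm_complete (coorbit sc \<pi> Y u) (coorbit_norm \<pi> N u)"
  unfolding seminorm_complete_def
proof (intro allI impI, elim conjE)
  fix f :: "nat \<Rightarrow> 's \<Rightarrow> complex"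
  assume f: "\<forall>n. f n \<in> coorbit sc \<pi> Y u"
    and cauchy: "\<forall>e>0. \<exists>k. \<forall>m\<ge>k. \<forall>n\<ge>k. coorbit_norm \<pi> N u (f m - f n) < e"
  have fd: "f n \<in> conj_dual sc" and fY: "W (f n) \<in> Y" for n
    using f by (auto simp: coorbit_def)
  have "\<forall>e>0. \<exists>k. \<forall>m\<ge>k. \<forall>n\<ge>k. N (W (f m) - W (f n)) < e"
    using cauchy by (simp add: coorbit_norm_def voice_diff)
  then obtain F where FY: "F \<in> Y" and lim: "(\<lambda>n. N (W (f n) - F)) \<longlonglongrightarrow> 0"
    using Y_complete[unfolded seminorm_complete_def, rule_format, of "\<lambda>n. W (f n)"] fY by blast
  have "(\<lambda>n. W (f n) y) \<longlonglongrightarrow> convolution \<mu> F kernel y" for y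
    using convolution_kernel_continuous[OF fY FY lim, of y]
    by (simp add: reproducing_formula(2)[OF fd])
  then have "AE x in \<mu>. F x = convolution \<mu> F kernel x"
    by (rule AE_eq_pointwise_limit_limit_in_measure[OF haar Y_measurable[OF fY] Y_measurable[OF FY]])
      (rule Y_local_measure[OF fY FY lim])
  then have F: "F \<in> reproducing_space \<mu> \<iota> \<pi> Y u"
    using FY convolution_exists_kernel[OF FY] by (simp add: reproducing_space_def)
  define \<phi> where "\<phi> = integrated_contragredient \<mu> \<pi> F (\<iota> u)"
  have \<phi>: "\<phi> \<in> coorbit sc \<pi> Y u" and ae: "AE x in \<mu>. W \<phi> x = F x"
    using integrated_contragredient_in_coorbit[OF F] by (simp_all add: \<phi>_def)
  then have \<phi>Y: "W \<phi> \<in> Y" by (simp add: coorbit_def)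
  have "AE x in \<mu>. (F - W \<phi>) x = 0" using ae by auto
  then have N0: "N (F - W \<phi>) = 0" using Y_norm_0[OF Y_diff[OF FY \<phi>Y]] by simp
  have "(\<lambda>n. coorbit_norm \<pi> N u (f n - \<phi>)) \<longlonglongrightarrow> 0"
  proof (rule tendsto_sandwich[OF _ _ tendsto_const lim])
    have "0 \<le> N (W (f n) - W \<phi>)" for n
      using Y_seminorm Y_diff[OF fY \<phi>Y] unfolding seminorm_on_def by blast
    then show "\<forall>\<^sub>F n in sequentially. 0 \<le> coorbit_norm \<pi> N u (f n - \<phi>)"
      by (simp add: coorbit_norm_def voice_diff)
    have "N ((W (f n) - F) + (F - W \<phi>)) \<le> N (W (f n) - F) + N (F - W \<phi>)" for n
      using Y_seminorm Y_diff[OF fY FY] Y_diff[OF FY \<phi>Y] unfolding seminorm_on_def by blast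
    then have "N (W (f n) - W \<phi>) \<le> N (W (f n) - F)" for n
      using N0 by simp
    then show "\<forall>\<^sub>F n in sequentially. coorbit_norm \<pi> N u (f n - \<phi>) \<le> N (W (f n) - F)"
      by (simp add: coorbit_norm_def voice_diff)
  qed
  then show "\<exists>\<phi>\<in>coorbit sc \<pi> Y u. (\<lambda>n. coorbit_norm \<pi> N u (f n - \<phi>)) \<longlonglongrightarrow> 0"
    using \<phi> by blast
qed

lemma coorbit_banach: "banach_space_on fun_scale (coorbit sc \<pi> Y u) (coorbit_norm \<pi> N u)"
  unfolding banach_space_on_def
proof (intro conjI ballI impI)
  show "seminorm_on fun_scale (coorbit sc \<pi> Y u) (coorbit_norm \<pi> N u)"
    using Y_seminorm
    unfolding seminorm_on_def coorbit_norm_def coorbit_def by (simp add: voice_add voice_scale)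
  \<comment> \<open>In \<open>Y\<close> norm zero means zero almost everywhere; for voice transforms this is zero everywhere.\<close>
  fix \<phi> assume \<phi>: "\<phi> \<in> coorbit sc \<pi> Y u" and "coorbit_norm \<pi> N u \<phi> = 0"
  then have "AE x in \<mu>. W \<phi> x = W 0 x"
    using Y_norm_0[of "W \<phi>"] by (simp add: coorbit_norm_def coorbit_def voice_def)
  then show "\<phi> = 0"
    using \<phi> module.subspace_0[OF module_fun_scale conj_dual_subspace[of sc]]
    by (intro AE_voice_eq_imp_eq) (auto simp: coorbit_def)
qed (fact coorbit_subspace coorbit_complete)+

lemma coorbit_invariant:
  "\<phi> \<in> coorbit sc \<pi> Y u \<Longrightarrow> contragredient \<pi> y \<phi> \<in> coorbit sc \<pi> Y u"
  by (simp add: coorbit_def contragredient_in_conj_dual[OF rep] voice_contragredient[OF rep]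
      Y_translate)

lemma voice_isometric_isomorphism:
  "isometric_isomorphism_ae \<mu> fun_scale (coorbit sc \<pi> Y u) (coorbit_norm \<pi> N u)
     (reproducing_space \<mu> \<iota> \<pi> Y u) N W"
  unfolding isometric_isomorphism_ae_def
proof (intro conjI ballI allI)
  fix F assume F: "F \<in> reproducing_space \<mu> \<iota> \<pi> Y u"
  show "\<exists>!\<phi>. \<phi> \<in> coorbit sc \<pi> Y u \<and> (AE x in \<mu>. W \<phi> x = F x)"
  proof (rule ex_ex1I)
    show "\<exists>\<phi>. \<phi> \<in> coorbit sc \<pi> Y u \<and> (AE x in \<mu>. W \<phi> x = F x)"
      using integrated_contragredient_in_coorbit[OF F] by blast
    fix \<phi> \<psi>
    assume \<phi>: "\<phi> \<in> coorbit sc \<pi> Y u \<and> (AE x in \<mu>. W \<phi> x = F x)"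
      and \<psi>: "\<psi> \<in> coorbit sc \<pi> Y u \<and> (AE x in \<mu>. W \<psi> x = F x)"
    then have "AE x in \<mu>. W \<phi> x = W \<psi> x" by auto
    then show "\<phi> = \<psi>" using \<phi> \<psi> by (intro AE_voice_eq_imp_eq) (auto simp: coorbit_def)
  qed
qed (auto simp: voice_add voice_scale coorbit_norm_def voice_in_reproducing_space)

end

theorem theorem2p3:
  fixes \<mu> :: "'g::{topological_group_add,t2_space} measure"
    and sc :: "complex \<Rightarrow> 's \<Rightarrow> 's::{ab_group_add,topological_space}"
    and \<iota> :: "'s \<Rightarrow> 's \<Rightarrow> complex"
    and \<pi> :: "'g \<Rightarrow> 's \<Rightarrow> 's"
    and Y :: "('g \<Rightarrow> complex) set"
    and N :: "('g \<Rightarrow> complex) \<Rightarrow> real"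
    and u :: 's
  assumes "locally_compact_space (euclidean :: 'g topology)"
    and "left_haar_measure \<mu>"
    and "frechet_space sc"
    and "dense_dual_embedding sc \<iota>"
    and "continuous_representation sc \<pi>"
    and "left_invariant_banach_function_space \<mu> Y N"
    and "analyzing_vector \<mu> sc \<iota> \<pi> Y N u"
  shows
    "(\<forall>\<phi>\<in>coorbit sc \<pi> Y u.
        convolution_exists \<mu> (voice \<pi> u \<phi>) (voice \<pi> u (\<iota> u)) \<and>
        convolution \<mu> (voice \<pi> u \<phi>) (voice \<pi> u (\<iota> u)) = voice \<pi> u \<phi>) \<and>
     (banach_space_on fun_scale (coorbit sc \<pi> Y u) (coorbit_norm \<pi> N u) \<and>
      (\<forall>y. \<forall>\<phi>\<in>coorbit sc \<pi> Y u. contragredient \<pi> y \<phi> \<in> coorbit sc \<pi> Y u)) \<and>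
     (\<forall>y. \<forall>\<phi>\<in>coorbit sc \<pi> Y u.
        voice \<pi> u (contragredient \<pi> y \<phi>) = left_translate y (voice \<pi> u \<phi>)) \<and>
     coorbit sc \<pi> Y u =
       (\<lambda>F. integrated_contragredient \<mu> \<pi> F (\<iota> u)) ` reproducing_space \<mu> \<iota> \<pi> Y u \<and>
     isometric_isomorphism_ae \<mu> fun_scale (coorbit sc \<pi> Y u) (coorbit_norm \<pi> N u)
       (reproducing_space \<mu> \<iota> \<pi> Y u) N (voice \<pi> u)"
proof -
  interpret coorbit_setting \<mu> sc \<iota> \<pi> Y N u
    by unfold_locales (fact assms)+
  have "\<phi> \<in> conj_dual sc" if "\<phi> \<in> coorbit sc \<pi> Y u" for \<phi>
    using that by (simp add: coorbit_def)
  then show ?thesis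
    using reproducing_formula coorbit_banach coorbit_invariant voice_contragredient[OF rep]
      coorbit_eq_image voice_isometric_isomorphism
    by blast
qed

end
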